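(* Let $p > 2$ be an even integer. Let $(s,c)$ be the solution pair on $[-2A_p, 2A_p]$ of the real initial value problem $s' = c^{p-1}$, $c' = -s^{p-1}$, $s(0)=0$, $c(0)=1$ that is given by $s|_{[-2A_p,0]} = s_-$, $c|_{[-2A_p,0]} = c_-$, $s|_{[0,2A_p]} = s_+$, $c|_{[0,2A_p]} = c_+$. Then $(s,c)$ extends to a solution pair of this initial value problem on the whole real line, with $4A_p$ as period (that is, $s(x+4A_p)=s(x)$ and $c(x+4A_p)=c(x)$ for all $x \in \mathbb{R}$).
   Context: A solution pair of the real initial value problem on an interval $I$ containing $0$ is a pair of real-valued differentiable functions on $I$ (with one-sided derivatives at any endpoints of $I$ that belong to $I$) satisfying the differential equations on $I$ and the initial conditions at $0$. For an even integer $p>2$, $A_p := \int_0^1 \frac{d\xi}{(1-\xi^p)^{1-1/p}}$ (a convergent integral). The function $c_+ : [0,2A_p] \to [-1,1]$ is the inverse of the strictly decreasing bijection $\gamma_+ : [-1,1] \to [0,2A_p]$, $\gamma_+(x) = \int_x^1 \frac{d\xi}{(1-\xi^p)^{1-1/p}}$, and $s_+ = (1-c_+^p)^{1/p}$. The function $c_- : [-2A_p,0] \to [-1,1]$ is the inverse of $\gamma_- : [-1,1] \to [-2A_p,0]$, $\gamma_-(x) = -\int_x^1 \frac{d\xi}{(1-\xi^p)^{1-1/p}}$, and $s_- = -(1-c_-^p)^{1/p}$. Here $p$th roots of nonnegative reals are nonnegative. *)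

theory Defs
  imports "HOL-Analysis.Analysis"
begin

text \<open>One-sided derivatives at endpoints belonging to \<open>I\<close> come from \<open>at x within I\<close>.\<close>

definition solution_pair ::
  "nat \<Rightarrow> real set \<Rightarrow> (real \<Rightarrow> real) \<Rightarrow> (real \<Rightarrow> real) \<Rightarrow> bool" where
  "solution_pair p I s c \<longleftrightarrow>
     is_interval I \<and> 0 \<in> I \<and>
     (\<forall>x\<in>I. (s has_real_derivative c x ^ (p - 1)) (at x within I)) \<and>
     (\<forall>x\<in>I. (c has_real_derivative - (s x ^ (p - 1))) (at x within I)) \<and>
     s 0 = 0 \<and> c 0 = 1"

text \<open>
  The integrand is unbounded near \<open>\<xi> = 1\<close> and \<open>\<xi> = - 1\<close> (even \<open>p\<close>); its value at these two points,
  which is 0 because division by zero yields 0, does not affect the Henstock--Kurzweil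
  integral, and this integral includes the convergent improper ones.
\<close>

definition integrand :: "nat \<Rightarrow> real \<Rightarrow> real" where
  "integrand p \<xi> = 1 / (1 - \<xi> ^ p) powr (1 - 1 / real p)"

definition A :: "nat \<Rightarrow> real" where
  "A p = integral {0..1} (integrand p)"

definition gamma_plus :: "nat \<Rightarrow> real \<Rightarrow> real" where
  "gamma_plus p x = integral {x..1} (integrand p)"

definition gamma_minus :: "nat \<Rightarrow> real \<Rightarrow> real" where
  "gamma_minus p x = - integral {x..1} (integrand p)"

text \<open>
  The following four functions are meaningful only on \<open>{0..2 * A p}\<close> (plus) and
  \<open>{- (2 * A p)..0}\<close> (minus), the images of \<open>{-1..1}\<close> under the two functions above.
\<close>

definition c_plus :: "nat \<Rightarrow> real \<Rightarrow> real" where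
  "c_plus p = inv_into {-1..1} (gamma_plus p)"

definition s_plus :: "nat \<Rightarrow> real \<Rightarrow> real" where
  "s_plus p x = root p (1 - c_plus p x ^ p)"

definition c_minus :: "nat \<Rightarrow> real \<Rightarrow> real" where
  "c_minus p = inv_into {-1..1} (gamma_minus p)"

definition s_minus :: "nat \<Rightarrow> real \<Rightarrow> real" where
  "s_minus p x = - root p (1 - c_minus p x ^ p)"

end

theory Submission
  imports Defs
begin

text \<open>
  The function \<open>\<gamma>\<^sub>+\<close> is continuous on \<open>[-1, 1]\<close> with derivative \<open>- (1 - x^p)^(1/p - 1)\<close> inside, so its
  inverse \<open>c\<^sub>+\<close> satisfies the equations in the interior of \<open>[0, 2 A\<^sub>p]\<close>. As both sides of the
  equations are continuous up to the endpoints, integrating them shows that they hold there too,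
  with one-sided derivatives. Since \<open>p - 1\<close> is odd, the minus branch is the reflection
  \<open>(- s\<^sub>+(- x), c\<^sub>+(- x))\<close> of the plus branch. Finally \<open>(s, c)\<close> takes the same value \<open>(0, -1)\<close> at both
  ends of \<open>[-2 A\<^sub>p, 2 A\<^sub>p]\<close>, so translates of it by multiples of \<open>4 A\<^sub>p\<close> glue together.
\<close>

section \<open>One-sided derivatives\<close>

lemma has_field_derivative_transform_on:
  assumes "x \<in> S" "(f has_field_derivative D) (at x within S)"
    and "\<And>y. y \<in> S \<Longrightarrow> g y = f y"
  shows "(g has_field_derivative D) (at x within S)"
  using has_derivative_transform[of x S g f] assms by (simp add: has_field_derivative_def)

text \<open>By the fundamental theorem with derivatives in the interior, \<open>f\<close> is
  \<open>f a\<close> plus the indefinite integral of \<open>g\<close>. Continuity of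
  \<open>g\<close> gives that integral the derivative \<open>g x\<close> even at an endpoint,
  one-sidedly.\<close>

lemma has_real_derivative_closed_interval:
  fixes f g :: "real \<Rightarrow> real"
  assumes "continuous_on {a..b} f" and "continuous_on {a..b} g"
    and deriv: "\<And>x. a < x \<Longrightarrow> x < b \<Longrightarrow> (f has_real_derivative g x) (at x)"
    and x: "x \<in> {a..b}"
  shows "(f has_real_derivative g x) (at x within {a..b})"
proof -
  have f_eq: "f y = f a + integral {a..y} g" if y: "y \<in> {a..b}" for y
  proof -
    have "(g has_integral (f y - f a)) {a..y}"
      using y deriv
      by (intro fundamental_theorem_of_calculus_interior continuous_on_subset[OF assms(1)])
        (auto simp: has_real_derivative_iff_has_vector_derivative)
    then show ?thesis by (simp add: integral_unique)
  qed
  have "((\<lambda>y. f a + integral {a..y} g) has_real_derivative g x) (at x within {a..b})"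
    using DERIV_add[OF DERIV_const integral_has_real_derivative[OF assms(2) x]] by simp
  then show ?thesis
    by (rule has_field_derivative_transform_on[OF x]) (rule f_eq)
qed

text \<open>At the joint \<open>b\<close> the filter within the union is the supremum of the two
  one-sided filters, and both derivatives are the same number \<open>g b\<close>. Elsewhere one
  piece alone determines the filter.\<close>

lemma has_real_derivative_closed_interval_combine:
  fixes f :: "real \<Rightarrow> real"
  assumes ab: "\<And>x. x \<in> {a..b} \<Longrightarrow> (f has_real_derivative g x) (at x within {a..b})"
    and bc: "\<And>x. x \<in> {b..c} \<Longrightarrow> (f has_real_derivative g x) (at x within {b..c})"
    and x: "x \<in> {a..c}" and le: "a \<le> b" "b \<le> c"
  shows "(f has_real_derivative g x) (at x within {a..c})"
proof -
  consider "x < b" | "x = b" | "b < x" by linarith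
  then show ?thesis
  proof cases
    case 1
    then have "at x within {a..c} = at x within {a..b}"
      using le by (intro at_within_nhd[of x "{..<b}"]) auto
    then show ?thesis using ab[of x] x 1 by simp
  next
    case 2
    have union: "{a..c} = {a..b} \<union> {b..c}" using le by auto
    show ?thesis
      using ab[of x] bc[of x] 2 le
      unfolding has_field_derivative_iff unfolding union at_within_union by (intro filterlim_sup) simp_all
  next
    case 3
    then have "at x within {a..c} = at x within {b..c}"
      using le by (intro at_within_nhd[of x "{b<..}"]) auto
    then show ?thesis using bc[of x] x 3 by simp
  qed
qed

lemma has_real_derivative_reflect_closed_interval:
  fixes f :: "real \<Rightarrow> real"
  assumes "(f has_real_derivative D) (at (- x) within {a..b})"
  shows "((\<lambda>y. f (- y)) has_real_derivative - D) (at x within {- b..- a})"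
proof -
  have "uminus ` {- b..- a} = {a..b}" by simp
  then have "(f \<circ> uminus has_real_derivative D * - 1) (at x within {- b..- a})"
    using assms by (intro DERIV_image_chain) (auto intro!: derivative_eq_intros)
  then show ?thesis by (simp add: o_def)
qed

lemma has_real_derivative_shift_closed_interval:
  fixes f :: "real \<Rightarrow> real"
  assumes "(f has_real_derivative D) (at (x - d) within {a..b})"
  shows "((\<lambda>y. f (y - d)) has_real_derivative D) (at x within {a + d..b + d})"
proof -
  have "(\<lambda>y. y - d) ` {a + d..b + d} = {a..b}"
    using image_add_atLeastAtMost[of "- d" "a + d" "b + d"] by simp
  then have "(f \<circ> (\<lambda>y. y - d) has_real_derivative D * 1) (at x within {a + d..b + d})"
    using assms by (intro DERIV_image_chain) (auto intro!: derivative_eq_intros)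
  then show ?thesis by (simp add: o_def)
qed

section \<open>The integral defining the inverse functions\<close>

lemma power_even_less_one:
  fixes x :: real
  assumes "even p" "p > 0" "- 1 < x" "x < 1"
  shows "x ^ p < 1"
proof -
  have "\<bar>x\<bar> ^ p < 1" using assms by (simp add: power_less_one_iff abs_less_iff)
  then show ?thesis using assms by (simp add: power_even_abs)
qed

lemma integrand_pos:
  assumes "even p" "p > 0" "- 1 < x" "x < 1"
  shows "0 < integrand p x"
  using power_even_less_one[OF assms] by (simp add: integrand_def)

lemma isCont_integrand:
  assumes "even p" "p > 0" "- 1 < x" "x < 1"
  shows "isCont (integrand p) x"
  unfolding integrand_def[abs_def]
  by (intro continuous_intros) (use power_even_less_one[OF assms] in auto)

text \<open>The integrand is dominated by \<open>(1 - x)^(1/p - 1)\<close>, because \<open>x^p \<le> x\<close> on \<open>[0, 1]\<close>.\<close>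

lemma integrand_integrable_unit:
  assumes "p > 1"
  shows "integrand p integrable_on {0..1}"
proof -
  define h where "h = (\<lambda>x::real. (1 - x) powr (1 / real p - 1))"
  \<comment> \<open>\<open>h\<close> is unbounded near 1, but its antiderivative
    \<open>- p * (1 - x) powr (1 / p)\<close> is continuous up to 1, so the fundamental theorem
    still yields integrability.\<close>
  have "(h has_integral ((- real p * (1 - 1) powr (1 / real p)) - (- real p * (1 - 0) powr (1 / real p)))) {0..1}"
  proof (rule fundamental_theorem_of_calculus_interior)
    show "continuous_on {0..1} (\<lambda>x. - real p * (1 - x) powr (1 / real p))"
      using assms by (intro continuous_intros continuous_on_powr') auto
    show "((\<lambda>x. - real p * (1 - x) powr (1 / real p)) has_vector_derivative h x) (at x)"
      if "x \<in> {0<..<1}" for x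
      unfolding has_real_derivative_iff_has_vector_derivative[symmetric] h_def
      using that assms by (auto intro!: derivative_eq_intros simp: field_simps)
  qed simp
  then have h: "h integrable_on {0..1}" by blast
  have "integrand p \<in> borel_measurable borel"
    unfolding integrand_def[abs_def] by measurable
  then have "integrand p \<in> borel_measurable (lebesgue_on {0..1})"
    by (intro measurable_restrict_space1 measurable_completion) simp
  then show ?thesis
  proof (rule measurable_bounded_by_integrable_imp_integrable_real[OF _ h])
    show "\<bar>integrand p x\<bar> \<le> h x" if x: "x \<in> {0..1}" for x
    proof (cases "x = 1")
      \<comment> \<open>Both sides are 0 here: \<open>0 powr r = 0\<close>, and division by zero
        gives 0.\<close>
      case True
      then show ?thesis by (simp add: integrand_def h_def)
    next
      case False
      have "x ^ p \<le> x ^ 1"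
        using x assms by (intro power_decreasing) auto
      then have "(1 - x) powr (1 - 1 / real p) \<le> (1 - x ^ p) powr (1 - 1 / real p)"
        using x assms by (intro powr_mono2) (auto simp: field_simps)
      then have "1 / (1 - x ^ p) powr (1 - 1 / real p) \<le> 1 / (1 - x) powr (1 - 1 / real p)"
        using x False by (intro divide_left_mono) (auto intro!: mult_pos_pos)
      also have "\<dots> = h x"
        by (simp add: h_def powr_minus_divide[symmetric])
      finally show ?thesis by (simp add: integrand_def)
    qed
  qed simp
qed

lemma integrand_has_integral_reflect:
  assumes "even p" "p > 1"
  shows "(integrand p has_integral A p) {- 1..0}"
proof -
  have "integrand p (- x) = integrand p x" for x
    using assms by (simp add: integrand_def)
  moreover have "((\<lambda>x. integrand p (- x)) has_integral A p) {- 1..- 0}"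
    unfolding has_integral_reflect_real A_def
    by (rule integrable_integral[OF integrand_integrable_unit[OF assms(2)]])
  ultimately show ?thesis by simp
qed

lemma integrand_has_integral:
  assumes "even p" "p > 1"
  shows "(integrand p has_integral 2 * A p) {- 1..1}"
proof -
  have "(integrand p has_integral A p) {0..1}"
    unfolding A_def by (rule integrable_integral[OF integrand_integrable_unit[OF assms(2)]])
  with integrand_has_integral_reflect[OF assms]
  have "(integrand p has_integral A p + A p) {- 1..1}"
    by (rule has_integral_combine[rotated 2]) auto
  then show ?thesis by simp
qed

section \<open>The bijection \<open>gamma_plus\<close>\<close>

lemma continuous_on_gamma_plus:
  assumes "even p" "p > 1"
  shows "continuous_on {- 1..1} (gamma_plus p)"
  unfolding gamma_plus_def[abs_def]
  using has_integral_integrable[OF integrand_has_integral[OF assms]]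
  by (rule indefinite_integral_continuous_1')

text \<open>The variable is the lower limit, so \<open>gamma_plus\<close> is written as the total
  integral minus the integral from -1. As the integrand is unbounded near -1 and 1, the fundamental
  theorem is applied at a single point of continuity.\<close>

lemma gamma_plus_has_real_derivative:
  assumes "even p" "p > 1" "- 1 < x" "x < 1"
  shows "(gamma_plus p has_real_derivative - integrand p x) (at x)"
proof -
  have int: "integrand p integrable_on {- 1..1}"
    using integrand_has_integral[OF assms(1,2)] by blast
  have int_at: "at x within {- 1..1} = at x"
    using assms by (intro at_within_interior) (auto simp: interior_atLeastAtMost_real)
  have "((\<lambda>u. integral {- 1..u} (integrand p)) has_real_derivative integrand p x) (at x within {- 1..1})"
    unfolding has_real_derivative_iff_has_vector_derivative
    using assms isCont_integrand[of p x]
      integral_has_vector_derivative_continuous_at[OF int, of x "{}"]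
    by (simp add: continuous_at_imp_continuous_at_within)
  then have "((\<lambda>u. integral {- 1..1} (integrand p) - integral {- 1..u} (integrand p))
      has_real_derivative - integrand p x) (at x within {- 1..1})"
    by (auto intro!: derivative_eq_intros)
  then have "(gamma_plus p has_real_derivative - integrand p x) (at x within {- 1..1})"
  proof (rule has_field_derivative_transform_on[rotated 1])
    show "x \<in> {- 1..1}" using assms by simp
    show "gamma_plus p u = integral {- 1..1} (integrand p) - integral {- 1..u} (integrand p)"
      if "u \<in> {- 1..1}" for u
      using that Henstock_Kurzweil_Integration.integral_combine[OF _ _ int, of u]
      by (simp add: gamma_plus_def)
  qed
  then show ?thesis by (simp add: int_at)
qed

text \<open>The derivative is negative between \<open>x\<close> and \<open>y\<close>; continuity
  carries the strict inequality to the ends, which may be the singular points -1 and 1.\<close>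

lemma gamma_plus_strict_antimono:
  assumes "even p" "p > 1" "- 1 \<le> x" "x < y" "y \<le> 1"
  shows "gamma_plus p y < gamma_plus p x"
proof (rule DERIV_neg_imp_decreasing_open[OF assms(4)])
  show "\<exists>D. (gamma_plus p has_real_derivative D) (at z) \<and> D < 0" if "x < z" "z < y" for z
    using that assms
    by (intro exI[of _ "- integrand p z"])
      (auto intro!: gamma_plus_has_real_derivative integrand_pos)
  show "continuous_on {x..y} (gamma_plus p)"
    using assms by (intro continuous_on_subset[OF continuous_on_gamma_plus]) auto
qed

lemma gamma_plus_one: "gamma_plus p 1 = 0"
  by (simp add: gamma_plus_def)

lemma gamma_plus_minus_one:
  "even p \<Longrightarrow> p > 1 \<Longrightarrow> gamma_plus p (- 1) = 2 * A p"
  by (simp add: gamma_plus_def integral_unique[OF integrand_has_integral])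

lemma A_pos: "even p \<Longrightarrow> p > 1 \<Longrightarrow> 0 < A p"
  using gamma_plus_strict_antimono[of p "- 1" 1]
  by (simp add: gamma_plus_one gamma_plus_minus_one)

lemma inj_on_gamma_plus:
  assumes "even p" "p > 1"
  shows "inj_on (gamma_plus p) {- 1..1}"
proof (rule inj_onI)
  fix x y
  assume "x \<in> {- 1..1}" "y \<in> {- 1..1}" "gamma_plus p x = gamma_plus p y"
  then show "x = y"
    using gamma_plus_strict_antimono[OF assms, of x y] gamma_plus_strict_antimono[OF assms, of y x]
    by (cases x y rule: linorder_cases) auto
qed

lemma gamma_plus_image:
  assumes "even p" "p > 1"
  shows "gamma_plus p ` {- 1..1} = {0..2 * A p}"
proof (intro equalityI subsetI)
  fix y
  assume "y \<in> gamma_plus p ` {- 1..1}"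
  then obtain x where x: "x \<in> {- 1..1}" "y = gamma_plus p x" by blast
  then show "y \<in> {0..2 * A p}"
    using gamma_plus_strict_antimono[OF assms, of x 1] gamma_plus_strict_antimono[OF assms, of "- 1" x]
      gamma_plus_one[of p] gamma_plus_minus_one[OF assms] A_pos[OF assms]
    by (cases "x = 1"; cases "x = - 1") auto
next
  fix y
  assume "y \<in> {0..2 * A p}"
  then have "\<exists>x\<ge>- 1. x \<le> 1 \<and> gamma_plus p x = y"
    using gamma_plus_one[of p] gamma_plus_minus_one[OF assms] continuous_on_gamma_plus[OF assms]
    by (intro IVT2') auto
  then show "y \<in> gamma_plus p ` {- 1..1}" by auto
qed

section \<open>The plus branch\<close>

lemma gamma_plus_c_plus:
  assumes "even p" "p > 1" "y \<in> {0..2 * A p}"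
  shows "gamma_plus p (c_plus p y) = y"
  unfolding c_plus_def
  by (rule f_inv_into_f) (use assms gamma_plus_image in simp)

lemma c_plus_mem:
  assumes "even p" "p > 1" "y \<in> {0..2 * A p}"
  shows "c_plus p y \<in> {- 1..1}"
  unfolding c_plus_def
  by (rule inv_into_into) (use assms gamma_plus_image in simp)

lemma c_plus_gamma_plus:
  assumes "even p" "p > 1" "x \<in> {- 1..1}"
  shows "c_plus p (gamma_plus p x) = x"
  unfolding c_plus_def
  by (rule inv_into_f_f[OF inj_on_gamma_plus[OF assms(1,2)] assms(3)])

lemma c_plus_0: "even p \<Longrightarrow> p > 1 \<Longrightarrow> c_plus p 0 = 1"
  using c_plus_gamma_plus[of p 1] by (simp add: gamma_plus_one)

lemma c_plus_2A: "even p \<Longrightarrow> p > 1 \<Longrightarrow> c_plus p (2 * A p) = - 1"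
  using c_plus_gamma_plus[of p "- 1"] by (simp add: gamma_plus_minus_one)

lemma c_plus_interior:
  assumes "even p" "p > 1" "0 < y" "y < 2 * A p"
  shows "- 1 < c_plus p y" and "c_plus p y < 1"
proof -
  have y: "y \<in> {0..2 * A p}" using assms by simp
  have "c_plus p y \<noteq> 1" "c_plus p y \<noteq> - 1"
    using gamma_plus_c_plus[OF assms(1,2) y] gamma_plus_one[of p]
      gamma_plus_minus_one[OF assms(1,2)] assms(3,4) by auto
  then show "- 1 < c_plus p y" "c_plus p y < 1"
    using c_plus_mem[OF assms(1,2) y] by auto
qed

text \<open>The inverse of a continuous injection on a compact set is continuous.\<close>

lemma continuous_on_c_plus:
  assumes "even p" "p > 1"
  shows "continuous_on {0..2 * A p} (c_plus p)"
  using continuous_on_inv[OF continuous_on_gamma_plus[OF assms], of "c_plus p"]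
  by (simp add: gamma_plus_image[OF assms] c_plus_gamma_plus[OF assms])

lemma continuous_on_s_plus:
  assumes "even p" "p > 1"
  shows "continuous_on {0..2 * A p} (s_plus p)"
  unfolding s_plus_def[abs_def]
  by (intro continuous_intros continuous_on_c_plus[OF assms])

text \<open>With \<open>u = 1 - c^p\<close>, the exponent \<open>(p - 1) / p\<close> of
  \<open>u\<close> is the one in the integrand. This identity turns the derivative of the inverse of
  \<open>gamma_plus\<close> into a power of \<open>s_plus\<close>.\<close>

lemma s_plus_power:
  assumes "even p" "p > 1" "0 < y" "y < 2 * A p"
  shows "s_plus p y ^ (p - 1) = inverse (integrand p (c_plus p y))"
proof -
  define u where "u = 1 - c_plus p y ^ p"
  have u: "0 < u"
    unfolding u_def using power_even_less_one[of p "c_plus p y"] c_plus_interior[OF assms] assms by simp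
  have "s_plus p y ^ (p - 1) = (u powr (1 / real p)) ^ (p - 1)"
    using u assms by (simp add: s_plus_def u_def root_powr_inverse)
  also have "\<dots> = u powr (1 / real p * real (p - 1))"
    using u by (simp add: powr_realpow[symmetric] powr_powr)
  also have "1 / real p * real (p - 1) = 1 - 1 / real p"
    using assms by (simp add: field_simps of_nat_diff)
  finally show ?thesis by (simp add: integrand_def u_def)
qed

lemma c_plus_has_real_derivative_interior:
  assumes "even p" "p > 1" "0 < y" "y < 2 * A p"
  shows "(c_plus p has_real_derivative - (s_plus p y ^ (p - 1))) (at y)"
proof -
  have "(c_plus p has_real_derivative inverse (- integrand p (c_plus p y))) (at y)"
  proof (rule DERIV_inverse_function[where f = "gamma_plus p"])
    show "(gamma_plus p has_real_derivative - integrand p (c_plus p y)) (at (c_plus p y))"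
      by (intro gamma_plus_has_real_derivative assms c_plus_interior)
    show "- integrand p (c_plus p y) \<noteq> 0"
      using integrand_pos[of p "c_plus p y"] c_plus_interior[OF assms] assms by simp
    show "isCont (c_plus p) y"
      using continuous_on_interior[OF continuous_on_c_plus[OF assms(1,2)], of y] assms
      by (simp add: interior_atLeastAtMost_real)
    show "gamma_plus p (c_plus p z) = z" if "0 < z" "z < 2 * A p" for z
      using that assms by (intro gamma_plus_c_plus) auto
  qed (use assms in auto)
  then show ?thesis by (simp only: s_plus_power[OF assms] inverse_minus_eq)
qed

text \<open>Differentiating the root gives \<open>p * c^(p-1) * s^(p-1) / (p * s^(p-1))\<close>. The
  cancellation uses \<open>s > 0\<close>, which holds in the interior but fails at the
  endpoints.\<close>

lemma s_plus_has_real_derivative_interior: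
  assumes "even p" "p > 1" "0 < y" "y < 2 * A p"
  shows "(s_plus p has_real_derivative c_plus p y ^ (p - 1)) (at y)"
proof -
  have u: "0 < 1 - c_plus p y ^ p"
    using power_even_less_one[of p "c_plus p y"] c_plus_interior[OF assms] assms by simp
  then have s: "s_plus p y > 0" using assms by (simp add: s_plus_def)
  have "((\<lambda>y. 1 - c_plus p y ^ p) has_real_derivative
      real p * (c_plus p y ^ (p - 1) * s_plus p y ^ (p - 1))) (at y)"
    by (rule derivative_eq_intros c_plus_has_real_derivative_interior[OF assms] refl)+
      simp
  from DERIV_chain2[OF DERIV_real_root[OF _ u] this, of p] assms s
  show ?thesis
    unfolding s_plus_def[abs_def, symmetric] by (simp add: s_plus_def[symmetric] field_simps)
qed

lemma c_plus_has_real_derivative: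
  assumes "even p" "p > 1" "y \<in> {0..2 * A p}"
  shows "(c_plus p has_real_derivative - (s_plus p y ^ (p - 1))) (at y within {0..2 * A p})"
  using assms
  by (intro has_real_derivative_closed_interval[where g = "\<lambda>y. - (s_plus p y ^ (p - 1))"]
      continuous_intros continuous_on_c_plus continuous_on_s_plus c_plus_has_real_derivative_interior)

lemma s_plus_has_real_derivative:
  assumes "even p" "p > 1" "y \<in> {0..2 * A p}"
  shows "(s_plus p has_real_derivative c_plus p y ^ (p - 1)) (at y within {0..2 * A p})"
  using assms
  by (intro has_real_derivative_closed_interval[where g = "\<lambda>y. c_plus p y ^ (p - 1)"]
      continuous_intros continuous_on_c_plus continuous_on_s_plus s_plus_has_real_derivative_interior)

section \<open>The minus branch and the periodic extension\<close>

text \<open>Since \<open>gamma_minus\<close> is the negative of \<open>gamma_plus\<close>,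
  \<open>c_plus p (- y)\<close> is a preimage of \<open>y\<close>, and by injectivity the only
  one.\<close>

lemma c_minus_reflect:
  assumes "even p" "p > 1" "y \<in> {- (2 * A p)..0}"
  shows "c_minus p y = c_plus p (- y)"
proof -
  have y: "- y \<in> {0..2 * A p}" using assms by auto
  have minus: "gamma_minus p = (\<lambda>x. - gamma_plus p x)"
    by (simp add: fun_eq_iff gamma_minus_def gamma_plus_def)
  have "inj_on (gamma_minus p) {- 1..1}"
    using inj_on_gamma_plus[OF assms(1,2)] by (auto simp: minus inj_on_def)
  then show ?thesis
    unfolding c_minus_def
    using c_plus_mem[OF assms(1,2) y] gamma_plus_c_plus[OF assms(1,2) y]
    by (intro inv_into_f_eq) (auto simp: minus)
qed

lemma s_minus_reflect:
  assumes "even p" "p > 1" "y \<in> {- (2 * A p)..0}"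
  shows "s_minus p y = - s_plus p (- y)"
  by (simp add: s_minus_def s_plus_def c_minus_reflect[OF assms])

lemma solution_pair_symmetric_interval:
  fixes p :: nat and s c :: "real \<Rightarrow> real"
  assumes p: "even p" "p > 1"
    and sm: "\<forall>x\<in>{- (2 * A p)..0}. s x = s_minus p x"
    and cm: "\<forall>x\<in>{- (2 * A p)..0}. c x = c_minus p x"
    and sp: "\<forall>x\<in>{0..2 * A p}. s x = s_plus p x"
    and cp: "\<forall>x\<in>{0..2 * A p}. c x = c_plus p x"
  shows "solution_pair p {- (2 * A p)..2 * A p} s c"
proof -
  have sm': "s x = - s_plus p (- x)" and cm': "c x = c_plus p (- x)"
    if "x \<in> {- (2 * A p)..0}" for x
    using that sm cm s_minus_reflect[OF p] c_minus_reflect[OF p] by auto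
  have s_right: "(s has_real_derivative c x ^ (p - 1)) (at x within {0..2 * A p})"
    if x: "x \<in> {0..2 * A p}" for x
    using has_field_derivative_transform_on[OF x s_plus_has_real_derivative[OF p x], of s] sp cp x
    by auto
  have c_right: "(c has_real_derivative - (s x ^ (p - 1))) (at x within {0..2 * A p})"
    if x: "x \<in> {0..2 * A p}" for x
    using has_field_derivative_transform_on[OF x c_plus_has_real_derivative[OF p x], of c] sp cp x
    by auto
  have s_left: "(s has_real_derivative c x ^ (p - 1)) (at x within {- (2 * A p)..0})"
    if x: "x \<in> {- (2 * A p)..0}" for x
  proof -
    have "- x \<in> {0..2 * A p}" using x by auto
    \<comment> \<open>The sign from reflecting the argument and the sign in front cancel.\<close>
    from DERIV_minus[OF has_real_derivative_reflect_closed_interval[OF s_plus_has_real_derivative[OF p this]]]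
    have "((\<lambda>y. - s_plus p (- y)) has_real_derivative c x ^ (p - 1)) (at x within {- (2 * A p)..0})"
      by (simp add: cm'[OF x])
    then show ?thesis
      by (rule has_field_derivative_transform_on[OF x]) (simp_all add: sm')
  qed
  have c_left: "(c has_real_derivative - (s x ^ (p - 1))) (at x within {- (2 * A p)..0})"
    if x: "x \<in> {- (2 * A p)..0}" for x
  proof -
    have "- x \<in> {0..2 * A p}" using x by auto
    \<comment> \<open>Reflection changes the derivative to \<open>s_plus p (- x) ^ (p - 1)\<close>,
      which is \<open>- (s x ^ (p - 1))\<close> because \<open>p - 1\<close> is odd.\<close>
    from has_real_derivative_reflect_closed_interval[OF c_plus_has_real_derivative[OF p this]]
    have "((\<lambda>y. c_plus p (- y)) has_real_derivative - (s x ^ (p - 1))) (at x within {- (2 * A p)..0})"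
      using p by (simp add: sm'[OF x])
    then show ?thesis
      by (rule has_field_derivative_transform_on[OF x]) (simp_all add: cm')
  qed
  have "(s has_real_derivative c x ^ (p - 1)) (at x within {- (2 * A p)..2 * A p})"
    and "(c has_real_derivative - (s x ^ (p - 1))) (at x within {- (2 * A p)..2 * A p})"
    if x: "x \<in> {- (2 * A p)..2 * A p}" for x
    using A_pos[OF p]
      has_real_derivative_closed_interval_combine[OF s_left s_right x]
      has_real_derivative_closed_interval_combine[OF c_left c_right x]
    by simp_all
  moreover have "s 0 = 0" "c 0 = 1"
    using sp cp A_pos[OF p] c_plus_0[OF p] by (auto simp: s_plus_def)
  ultimately show ?thesis
    using A_pos[OF p] by (simp add: solution_pair_def is_interval_cc)
qed

section \<open>Gluing translates into a periodic function\<close>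

text \<open>Prescribing \<open>F\<close> and \<open>G\<close> on all closed translates makes
  neighbouring pieces agree at their common endpoint, so their one-sided derivatives
  combine.\<close>

lemma has_real_derivative_periodic_extension:
  fixes f g F G :: "real \<Rightarrow> real"
  assumes a: "a > 0"
    and deriv: "\<And>x. x \<in> {- a..a} \<Longrightarrow> (f has_real_derivative g x) (at x within {- a..a})"
    and F: "\<And>x k. x \<in> {- a..a} \<Longrightarrow> F (x + of_int k * (2 * a)) = f x"
    and G: "\<And>x k. x \<in> {- a..a} \<Longrightarrow> G (x + of_int k * (2 * a)) = g x"
  shows "(F has_real_derivative G x) (at x)"
proof -
  have piece: "(F has_real_derivative G y) (at y within {- a + of_int k * (2 * a)..a + of_int k * (2 * a)})"
    if y: "y \<in> {- a + of_int k * (2 * a)..a + of_int k * (2 * a)}" for y and k :: int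
  proof -
    have z: "z - of_int k * (2 * a) \<in> {- a..a}"
      if "z \<in> {- a + of_int k * (2 * a)..a + of_int k * (2 * a)}" for z
      using that by auto
    have Fz: "F z = f (z - of_int k * (2 * a))" and Gz: "G z = g (z - of_int k * (2 * a))"
      if "z \<in> {- a + of_int k * (2 * a)..a + of_int k * (2 * a)}" for z
      using F[OF z[OF that], of k] G[OF z[OF that], of k] by auto
    from has_real_derivative_shift_closed_interval[OF deriv[OF z[OF y]]]
    have "((\<lambda>z. f (z - of_int k * (2 * a))) has_real_derivative G y)
        (at y within {- a + of_int k * (2 * a)..a + of_int k * (2 * a)})"
      by (simp add: Gz[OF y])
    then show ?thesis
      by (rule has_field_derivative_transform_on[OF y]) (rule Fz)
  qed
  \<comment> \<open>\<open>k\<close> is the index of the half-open translate, closed on the left,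
    that contains \<open>x\<close>.\<close>
  define k where "k = \<lfloor>(x + a) / (2 * a)\<rfloor>"
  have "of_int k \<le> (x + a) / (2 * a)" "(x + a) / (2 * a) < of_int k + 1"
    unfolding k_def by linarith+
  then have k: "- a + of_int k * (2 * a) \<le> x" "x < a + of_int k * (2 * a)"
    using a by (auto simp: field_simps)
  have join: "a + of_int (k - 1) * (2 * a) = - a + of_int k * (2 * a)"
    by (simp add: algebra_simps)
  \<comment> \<open>\<open>x\<close> may be the left end of translate \<open>k\<close>; adding
    translate \<open>k - 1\<close> makes it an interior point, so the derivative becomes
    two-sided.\<close>
  let ?I = "{- a + of_int (k - 1) * (2 * a)..a + of_int k * (2 * a)}"
  have lower: "- a + of_int (k - 1) * (2 * a) < x"
    using k(1) join a by linarith
  have "(F has_real_derivative G x) (at x within ?I)"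
    by (rule has_real_derivative_closed_interval_combine[where b = "- a + of_int k * (2 * a)"])
      (use piece[of _ "k - 1", unfolded join] piece[of _ k] k lower a join in auto)
  moreover have "at x within ?I = at x"
    using lower k(2) by (intro at_within_interior) (auto simp: interior_atLeastAtMost_real)
  ultimately show ?thesis by simp
qed

text \<open>For \<open>a > 0\<close> the floor moves \<open>x\<close> to its representative in the
  half-open interval from \<open>- a\<close> to \<open>a\<close>, with \<open>- a\<close>
  included.\<close>

definition periodic_extension :: "real \<Rightarrow> (real \<Rightarrow> real) \<Rightarrow> real \<Rightarrow> real" where
  "periodic_extension a f x = f (x - of_int \<lfloor>(x + a) / (2 * a)\<rfloor> * (2 * a))"

lemma periodic_extension_eq:
  assumes a: "a > 0" and ends: "f (- a) = f a" and x: "x \<in> {- a..a}"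
  shows "periodic_extension a f (x + of_int k * (2 * a)) = f x"
proof -
  have "(x + of_int k * (2 * a) + a) / (2 * a) = (x + a) / (2 * a) + of_int k"
    using a by (simp add: field_simps)
  then have floor: "\<lfloor>(x + of_int k * (2 * a) + a) / (2 * a)\<rfloor> = \<lfloor>(x + a) / (2 * a)\<rfloor> + k"
    by simp
  show ?thesis
  proof (cases "x = a")
    case True
    \<comment> \<open>The right end is folded onto \<open>- a\<close>, so equality of
      \<open>f\<close> at the two ends enters here.\<close>
    then have one: "\<lfloor>(x + a) / (2 * a)\<rfloor> = 1" using a by simp
    show ?thesis
      unfolding periodic_extension_def floor one using True ends by (simp add: algebra_simps)
  next
    case False
    then have "\<lfloor>(x + a) / (2 * a)\<rfloor> = 0"
      using a x by (intro floor_unique) (auto simp: field_simps)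
    then show ?thesis by (simp add: periodic_extension_def floor)
  qed
qed

lemma periodic_extension_periodic:
  assumes "a > 0"
  shows "periodic_extension a f (x + 2 * a) = periodic_extension a f x"
proof -
  have "(x + 2 * a + a) / (2 * a) = (x + a) / (2 * a) + 1"
    using assms by (simp add: field_simps)
  then show ?thesis
    unfolding periodic_extension_def by (simp add: algebra_simps)
qed

theorem theorem4:
  fixes p :: nat and s c :: "real \<Rightarrow> real"
  assumes "even p" and "p > 2"
    and "\<forall>x\<in>{- (2 * A p)..0}. s x = s_minus p x"
    and "\<forall>x\<in>{- (2 * A p)..0}. c x = c_minus p x"
    and "\<forall>x\<in>{0..2 * A p}. s x = s_plus p x"
    and "\<forall>x\<in>{0..2 * A p}. c x = c_plus p x"
  shows "solution_pair p {- (2 * A p)..2 * A p} s c \<and>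
    (\<exists>S C. solution_pair p UNIV S C \<and>
      (\<forall>x\<in>{- (2 * A p)..2 * A p}. S x = s x \<and> C x = c x) \<and>
      (\<forall>x. S (x + 4 * A p) = S x \<and> C (x + 4 * A p) = C x))"
proof -
  have p: "even p" "p > 1" using assms by auto
  \<comment> \<open>Half the period: \<open>2 * a\<close> is \<open>4 * A p\<close>.\<close>
  define a where "a = 2 * A p"
  have a: "a > 0" using A_pos[OF p] by (simp add: a_def)
  have sol: "solution_pair p {- a..a} s c"
    unfolding a_def using p assms(3-6) by (rule solution_pair_symmetric_interval)
  have "c (- a) = - 1" "c a = - 1"
    using assms(4,6) a c_plus_2A[OF p] c_minus_reflect[OF p, of "- a"] by (auto simp: a_def)
  \<comment> \<open>From \<open>c = - 1\<close> at the ends: \<open>1 - (- 1)^p = 0\<close> for even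
    \<open>p\<close>, so the odd function \<open>s\<close> also closes up.\<close>
  moreover have "s a = 0" "s (- a) = 0"
    using assms(3,5) a c_plus_2A[OF p] s_minus_reflect[OF p, of "- a"] p
    by (auto simp: a_def s_plus_def)
  ultimately have ends: "c (- a) = c a" "s (- a) = s a" by simp_all
  let ?S = "periodic_extension a s" and ?C = "periodic_extension a c"
  note S = periodic_extension_eq[OF a ends(2)] and C = periodic_extension_eq[OF a ends(1)]
  have S0: "?S x = s x" and C0: "?C x = c x" if "x \<in> {- a..a}" for x
    using S[OF that, of 0] C[OF that, of 0] by simp_all
  \<comment> \<open>Extension by translation commutes with powers, so the right-hand side for the
    extended pair is the extension of the right-hand side for \<open>(s, c)\<close>.\<close>
  have "(?S has_real_derivative ?C x ^ (p - 1)) (at x)" for x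
    by (rule has_real_derivative_periodic_extension[OF a, where f = s and g = "\<lambda>x. c x ^ (p - 1)"])
      (use sol S C in \<open>auto simp: solution_pair_def\<close>)
  moreover have "(?C has_real_derivative - (?S x ^ (p - 1))) (at x)" for x
    by (rule has_real_derivative_periodic_extension[OF a, where f = c and g = "\<lambda>x. - (s x ^ (p - 1))"
          and G = "\<lambda>x. - (?S x ^ (p - 1))"])
      (use sol S C in \<open>auto simp: solution_pair_def\<close>)
  ultimately have "solution_pair p UNIV ?S ?C"
    using sol S0[of 0] C0[of 0] a by (simp add: solution_pair_def)
  moreover have "?S (x + 4 * A p) = ?S x" "?C (x + 4 * A p) = ?C x" for x
    using periodic_extension_periodic[OF a, of _ x] by (simp_all add: a_def)
  ultimately show ?thesis
    using sol S0 C0 unfolding a_def by blast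
qed

end
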